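(* Let $(\mathbf{W},\mathbf{w})$ and $(\mathbf{V},\mathbf{v})$ be fusion frames for $\mathcal{H}$, and let $(T_i)_{i=1}^m$ and $(\widetilde{T}_i)_{i=1}^m$ be projective $(m,\mathbf{n},\mathcal{H})$-reconstruction systems such that $R(T_i)=W_i$, $\|T_i\|_{sp}=w_i$, and $R(\widetilde{T}_i)=V_i$, $\|\widetilde{T}_i\|_{sp}=v_i$, for $i=1,\ldots,m$. For each $i$ let $\{e_{n_i}^l\}_{l=1}^{n_i}$ be an orthonormal basis for $\mathbb{F}^{n_i}$, and set $\mathcal{F}_i=\{\frac{1}{w_i}T_ie_{n_i}^l\}_{l=1}^{n_i}$ and $\mathcal{G}_i=\{\frac{1}{v_i}\widetilde{T}_ie_{n_i}^l\}_{l=1}^{n_i}$. Then the following conditions are equivalent: (1) $(\mathbf{V},\mathbf{v},\mathcal{G})$ is a dual fusion frame system of $(\mathbf{W},\mathbf{w},\mathcal{F})$. (2) $(\widetilde{T}_i)_{i=1}^m$ is a dual $(m,\mathbf{n},\mathcal{H})$-reconstruction system of $(T_i)_{i=1}^m$.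
   Context: $\mathcal{H}$ is a finite-dimensional Hilbert space over $\mathbb{F}=\mathbb{R}$ or $\mathbb{C}$, $m\in\mathbb{N}$, $\mathbf{n}=(n_1,\ldots,n_m)\in\mathbb{N}^m$. $L(\mathcal{X},\mathcal{Y})$ is the space of linear maps, $R(T)$ the image of $T$, $\|T\|_{sp}$ the spectral (operator) norm. Reconstruction systems: a sequence $(T_i)_{i=1}^m$ with $T_i\in L(\mathbb{F}^{n_i},\mathcal{H})$ is an $(m,\mathbf{n},\mathcal{H})$-reconstruction system if $\mathrm{span}\bigcup_iR(T_i)=\mathcal{H}$. Its synthesis operator is $T:\bigoplus_i\mathbb{F}^{n_i}\to\mathcal{H}$, $T(x_i)_i=\sum_iT_ix_i$, with adjoint $T^*f=(T_i^*f)_i$. It is projective if there are $w_i>0$ with $T_i^*T_i=w_i^2I_{\mathbb{F}^{n_i}}$ for $i=1,\ldots,m$. Two $(m,\mathbf{n},\mathcal{H})$-reconstruction systems $(T_i)$ and $(\widetilde T_i)$ with synthesis operators $T,\widetilde T$ are dual if $\widetilde TT^*=I_{\mathcal{H}}$. Fusion frames: $(\mathbf{W},\mathbf{w})=\{(W_i,w_i)\}_{i=1}^m$, a family of subspaces of $\mathcal{H}$ with weights $w_i>0$, is a fusion frame for $\mathcal{H}$ if $\mathrm{span}\bigcup_iW_i=\mathcal{H}$. Put $\mathcal{W}=\bigoplus_{i=1}^m W_i$ (external direct sum, with inner product $\sum_i\langle f_i,g_i\rangle$) and $T_{\mathbf{W},\mathbf{w}}:\mathcal{W}\to\mathcal{H}$,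 $T_{\mathbf{W},\mathbf{w}}(f_i)_i=\sum_iw_if_i$, with adjoint $T^*_{\mathbf{W},\mathbf{w}}f=(w_i\pi_{W_i}f)_i$, $\pi_{W_i}$ the orthogonal projection onto $W_i$; similarly $\mathcal{V}=\bigoplus_iV_i$ and $T_{\mathbf{V},\mathbf{v}}$. For linear $Q:\mathcal{W}\to\mathcal{V}$, a fusion frame $(\mathbf{V},\mathbf{v})$ is a $Q$-dual fusion frame of $(\mathbf{W},\mathbf{w})$ if $T_{\mathbf{V},\mathbf{v}}QT^*_{\mathbf{W},\mathbf{w}}=I_{\mathcal{H}}$. Fusion frame systems: a finite family is a frame for a finite-dimensional space if it spans it. $(\mathbf{W},\mathbf{w},\mathcal{F})$, with $\mathcal{F}=\{\mathcal{F}_i\}_{i=1}^m$, $\mathcal{F}_i=\{f_i^l\}_{l\in L_i}$ a frame for $W_i$ and $(\mathbf{W},\mathbf{w})$ a fusion frame for $\mathcal{H}$, is called a fusion frame system for $\mathcal{H}$. Let $C_{\mathcal{F}}:\bigoplus_i\mathbb{F}^{|L_i|}\to\mathcal{W}$, $C_{\mathcal{F}}((x_i^l)_{l\in L_i})_i=(\sum_{l\in L_i}x_i^lf_i^l)_i$, with adjoint $C^*_{\mathcal{F}}(g_i)_i=((\langle g_i,f_i^l\rangle)_{l\in L_i})_i$. A fusion frame system $(\mathbf{V},\mathbf{v},\mathcal{G})$, where $\mathcal{G}_i$ has the same index set $L_i$ as $\mathcal{F}_i$, is a dual fusion frame system of $(\mathbf{W},\mathbf{w},\mathcal{F})$ if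 $(\mathbf{V},\mathbf{v})$ is a $C_{\mathcal{G}}C^*_{\mathcal{F}}$-dual fusion frame of $(\mathbf{W},\mathbf{w})$. *)

theory Defs
  imports Complex_Main "HOL-Library.Function_Algebras"
begin

text \<open>
  The scalar field is \<open>\<real>\<close> or \<open>\<complex>\<close>, treated uniformly by a type class.  By Gelfand--Mazur, a
  commutative normed field over \<open>\<real>\<close> is \<open>\<real>\<close> or \<open>\<complex>\<close>, and the last axiom forces the conjugation to be
  the usual one (the identity on \<open>\<real>\<close>, \<open>cnj\<close> on \<open>\<complex>\<close>).
\<close>

class conj_normed_field = real_normed_field +
  fixes conjugate :: "'a \<Rightarrow> 'a"
  assumes conjugate_add: "conjugate (x + y) = conjugate x + conjugate y"
    and conjugate_mult: "conjugate (x * y) = conjugate x * conjugate y"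
    and conjugate_conjugate: "conjugate (conjugate x) = x"
    and mult_conjugate: "x * conjugate x = (norm x)\<^sup>2 *\<^sub>R 1"

instantiation real :: conj_normed_field
begin
definition conjugate_real :: "real \<Rightarrow> real" where "conjugate_real x = x"
instance by standard (simp_all add: conjugate_real_def power2_eq_square)
end

instantiation complex :: conj_normed_field
begin
definition conjugate_complex :: "complex \<Rightarrow> complex" where "conjugate_complex = cnj"
instance by standard (simp_all add: conjugate_complex_def scaleR_conv_of_real complex_norm_square [symmetric] flip: of_real_power)
end

text \<open>
  Inner products are linear in the first argument.  Completeness is automatic in finite dimension.
\<close>

locale fd_hilbert_space = vector_space scale
  for scale :: "'f::conj_normed_field \<Rightarrow> 'h::ab_group_add \<Rightarrow> 'h" +
  fixes ip :: "'h \<Rightarrow> 'h \<Rightarrow> 'f"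
  assumes ip_add_left: "ip (x + y) z = ip x z + ip y z"
    and ip_scale_left: "ip (scale c x) z = c * ip x z"
    and ip_commute: "ip y x = conjugate (ip x y)"
    and ip_self_nonneg: "\<exists>r\<ge>0. ip x x = of_real r"
    and ip_self_eq_zero: "ip x x = 0 \<Longrightarrow> x = 0"
    and finite_dim: "\<exists>B. finite B \<and> span B = UNIV"


subsection \<open>Linear maps between subspaces, adjoints, operator norm\<close>

text \<open>
  Linear subspaces are sets \<open>X\<close>, \<open>Y\<close> in ambient types; a map is only looked at on its domain.
\<close>

definition linear_map_on ::
  "('f \<Rightarrow> 'x \<Rightarrow> 'x) \<Rightarrow> 'x set \<Rightarrow> ('f \<Rightarrow> 'y \<Rightarrow> 'y) \<Rightarrow> 'y set \<Rightarrow> ('x::plus \<Rightarrow> 'y::plus) \<Rightarrow> bool" where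
  "linear_map_on sX X sY Y T \<longleftrightarrow>
     (\<forall>x\<in>X. T x \<in> Y) \<and>
     (\<forall>x\<in>X. \<forall>x'\<in>X. T (x + x') = T x + T x') \<and>
     (\<forall>c. \<forall>x\<in>X. T (sX c x) = sY c (T x))"

text \<open>
  The adjoint of \<open>T : X \<rightarrow> Y\<close>; the representing vector exists and is unique whenever \<open>X\<close> is a
  finite-dimensional inner product space and \<open>T\<close> is linear on it.
\<close>

definition adjoint_on ::
  "'x set \<Rightarrow> ('x \<Rightarrow> 'x \<Rightarrow> 'f) \<Rightarrow> ('y \<Rightarrow> 'y \<Rightarrow> 'f) \<Rightarrow> ('x \<Rightarrow> 'y) \<Rightarrow> 'y \<Rightarrow> 'x" where
  "adjoint_on X ipX ipY T y = (THE x. x \<in> X \<and> (\<forall>z\<in>X. ipY (T z) y = ipX z x))"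

definition ip_norm :: "('x \<Rightarrow> 'x \<Rightarrow> 'f::real_normed_vector) \<Rightarrow> 'x \<Rightarrow> real" where
  "ip_norm ip x = sqrt (norm (ip x x))"

text \<open>The zero vector contributes \<open>0 / 0 = 0\<close>.\<close>

definition spectral_norm ::
  "'x set \<Rightarrow> ('x \<Rightarrow> 'x \<Rightarrow> 'f::real_normed_vector) \<Rightarrow> ('y \<Rightarrow> 'y \<Rightarrow> 'f) \<Rightarrow> ('x \<Rightarrow> 'y) \<Rightarrow> real" where
  "spectral_norm X ipX ipY T = (SUP x\<in>X. ip_norm ipY (T x) / ip_norm ipX x)"


subsection \<open>External direct sums and coordinate spaces\<close>

text \<open>
  Families indexed by \<open>I\<close> are functions that vanish outside \<open>I\<close>, so that a direct sum is a
  subspace of a function type under the pointwise operations.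
\<close>

definition dsum :: "'i set \<Rightarrow> ('i \<Rightarrow> 'x::zero set) \<Rightarrow> ('i \<Rightarrow> 'x) set" where
  "dsum I X = {x. (\<forall>i\<in>I. x i \<in> X i) \<and> (\<forall>i. i \<notin> I \<longrightarrow> x i = 0)}"

definition dsum_scale :: "('f \<Rightarrow> 'x \<Rightarrow> 'x) \<Rightarrow> 'f \<Rightarrow> ('i \<Rightarrow> 'x) \<Rightarrow> ('i \<Rightarrow> 'x)" where
  "dsum_scale s c x = (\<lambda>i. s c (x i))"

definition dsum_ip ::
  "'i set \<Rightarrow> ('i \<Rightarrow> 'x \<Rightarrow> 'x \<Rightarrow> 'f::comm_monoid_add) \<Rightarrow> ('i \<Rightarrow> 'x) \<Rightarrow> ('i \<Rightarrow> 'x) \<Rightarrow> 'f" where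
  "dsum_ip I ip x y = (\<Sum>i\<in>I. ip i (x i) (y i))"

text \<open>The space \<open>\<bbbF>\<^bsup>|L|\<^esup>\<close> with coordinates indexed by a finite set \<open>L\<close>, for example \<open>{1..n}\<close>.\<close>

definition coords :: "'l set \<Rightarrow> ('l \<Rightarrow> 'f::conj_normed_field) set" where
  "coords L = dsum L (\<lambda>_. UNIV)"

definition coords_scale :: "'f \<Rightarrow> ('l \<Rightarrow> 'f) \<Rightarrow> ('l \<Rightarrow> 'f::conj_normed_field)" where
  "coords_scale = dsum_scale (*)"

definition coords_ip :: "'l set \<Rightarrow> ('l \<Rightarrow> 'f) \<Rightarrow> ('l \<Rightarrow> 'f) \<Rightarrow> 'f::conj_normed_field" where
  "coords_ip L = dsum_ip L (\<lambda>_ a b. a * conjugate b)"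

definition orthonormal_basis_coords ::
  "nat \<Rightarrow> (nat \<Rightarrow> nat \<Rightarrow> 'f::conj_normed_field) \<Rightarrow> bool" where
  "orthonormal_basis_coords n e \<longleftrightarrow>
     (\<forall>k\<in>{1..n}. \<forall>l\<in>{1..n}. coords_ip {1..n} (e k) (e l) = (if k = l then 1 else 0)) \<and>
     module.span coords_scale (e ` {1..n}) = coords {1..n}"


subsection \<open>Reconstruction systems\<close>

definition reconstruction_system ::
  "('f::conj_normed_field \<Rightarrow> 'h \<Rightarrow> 'h::ab_group_add) \<Rightarrow> nat \<Rightarrow> (nat \<Rightarrow> nat) \<Rightarrow>
   (nat \<Rightarrow> (nat \<Rightarrow> 'f) \<Rightarrow> 'h) \<Rightarrow> bool" where
  "reconstruction_system scale m n T \<longleftrightarrow>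
     (\<forall>i\<in>{1..m}. linear_map_on coords_scale (coords {1..n i}) scale UNIV (T i)) \<and>
     module.span scale (\<Union>i\<in>{1..m}. T i ` coords {1..n i}) = UNIV"

definition synthesis ::
  "nat \<Rightarrow> (nat \<Rightarrow> (nat \<Rightarrow> 'f) \<Rightarrow> 'h::ab_group_add) \<Rightarrow> (nat \<Rightarrow> nat \<Rightarrow> 'f) \<Rightarrow> 'h" where
  "synthesis m T x = (\<Sum>i=1..m. T i (x i))"

definition analysis ::
  "('h \<Rightarrow> 'h \<Rightarrow> 'f::conj_normed_field) \<Rightarrow> nat \<Rightarrow> (nat \<Rightarrow> nat) \<Rightarrow>
   (nat \<Rightarrow> (nat \<Rightarrow> 'f) \<Rightarrow> 'h::ab_group_add) \<Rightarrow> 'h \<Rightarrow> (nat \<Rightarrow> nat \<Rightarrow> 'f)" where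
  "analysis ip m n T =
     adjoint_on (dsum {1..m} (\<lambda>i. coords {1..n i})) (dsum_ip {1..m} (\<lambda>i. coords_ip {1..n i}))
       ip (synthesis m T)"

definition projective_reconstruction_system ::
  "('f::conj_normed_field \<Rightarrow> 'h \<Rightarrow> 'h::ab_group_add) \<Rightarrow> ('h \<Rightarrow> 'h \<Rightarrow> 'f) \<Rightarrow> nat \<Rightarrow> (nat \<Rightarrow> nat) \<Rightarrow>
   (nat \<Rightarrow> (nat \<Rightarrow> 'f) \<Rightarrow> 'h) \<Rightarrow> bool" where
  "projective_reconstruction_system scale ip m n T \<longleftrightarrow>
     reconstruction_system scale m n T \<and>
     (\<exists>w :: nat \<Rightarrow> real. \<forall>i\<in>{1..m}. w i > 0 \<and>
        (\<forall>x\<in>coords {1..n i}.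
           adjoint_on (coords {1..n i}) (coords_ip {1..n i}) ip (T i) (T i x) =
             coords_scale (of_real ((w i)\<^sup>2)) x))"

definition dual_reconstruction_system ::
  "('f::conj_normed_field \<Rightarrow> 'h \<Rightarrow> 'h::ab_group_add) \<Rightarrow> ('h \<Rightarrow> 'h \<Rightarrow> 'f) \<Rightarrow> nat \<Rightarrow> (nat \<Rightarrow> nat) \<Rightarrow>
   (nat \<Rightarrow> (nat \<Rightarrow> 'f) \<Rightarrow> 'h) \<Rightarrow> (nat \<Rightarrow> (nat \<Rightarrow> 'f) \<Rightarrow> 'h) \<Rightarrow> bool" where
  "dual_reconstruction_system scale ip m n T' T \<longleftrightarrow>
     reconstruction_system scale m n T' \<and> reconstruction_system scale m n T \<and>
     (\<forall>f. synthesis m T' (analysis ip m n T f) = f)"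


subsection \<open>Fusion frames\<close>

definition fusion_frame ::
  "('f::conj_normed_field \<Rightarrow> 'h \<Rightarrow> 'h::ab_group_add) \<Rightarrow> nat \<Rightarrow> (nat \<Rightarrow> 'h set) \<Rightarrow> (nat \<Rightarrow> real) \<Rightarrow>
   bool" where
  "fusion_frame scale m W w \<longleftrightarrow>
     (\<forall>i\<in>{1..m}. module.subspace scale (W i) \<and> w i > 0) \<and>
     module.span scale (\<Union>i\<in>{1..m}. W i) = UNIV"

definition fusion_synthesis ::
  "('f::conj_normed_field \<Rightarrow> 'h \<Rightarrow> 'h::ab_group_add) \<Rightarrow> nat \<Rightarrow> (nat \<Rightarrow> real) \<Rightarrow> (nat \<Rightarrow> 'h) \<Rightarrow> 'h" where
  "fusion_synthesis scale m w f = (\<Sum>i=1..m. scale (of_real (w i)) (f i))"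

definition fusion_analysis ::
  "('f::conj_normed_field \<Rightarrow> 'h \<Rightarrow> 'h::ab_group_add) \<Rightarrow> ('h \<Rightarrow> 'h \<Rightarrow> 'f) \<Rightarrow> nat \<Rightarrow>
   (nat \<Rightarrow> 'h set) \<Rightarrow> (nat \<Rightarrow> real) \<Rightarrow> 'h \<Rightarrow> (nat \<Rightarrow> 'h)" where
  "fusion_analysis scale ip m W w =
     adjoint_on (dsum {1..m} W) (dsum_ip {1..m} (\<lambda>_. ip)) ip (fusion_synthesis scale m w)"

definition Q_dual_fusion_frame ::
  "('f::conj_normed_field \<Rightarrow> 'h \<Rightarrow> 'h::ab_group_add) \<Rightarrow> ('h \<Rightarrow> 'h \<Rightarrow> 'f) \<Rightarrow> nat \<Rightarrow>
   ((nat \<Rightarrow> 'h) \<Rightarrow> (nat \<Rightarrow> 'h)) \<Rightarrow>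
   (nat \<Rightarrow> 'h set) \<Rightarrow> (nat \<Rightarrow> real) \<Rightarrow> (nat \<Rightarrow> 'h set) \<Rightarrow> (nat \<Rightarrow> real) \<Rightarrow> bool" where
  "Q_dual_fusion_frame scale ip m Q V v W w \<longleftrightarrow>
     fusion_frame scale m V v \<and> fusion_frame scale m W w \<and>
     linear_map_on (dsum_scale scale) (dsum {1..m} W) (dsum_scale scale) (dsum {1..m} V) Q \<and>
     (\<forall>f. fusion_synthesis scale m v (Q (fusion_analysis scale ip m W w f)) = f)"


subsection \<open>Fusion frame systems\<close>

definition frame_for ::
  "('f::conj_normed_field \<Rightarrow> 'h \<Rightarrow> 'h::ab_group_add) \<Rightarrow> 'h set \<Rightarrow> 'l set \<Rightarrow> ('l \<Rightarrow> 'h) \<Rightarrow> bool" where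
  "frame_for scale U L f \<longleftrightarrow> finite L \<and> module.span scale (f ` L) = U"

definition fusion_frame_system ::
  "('f::conj_normed_field \<Rightarrow> 'h \<Rightarrow> 'h::ab_group_add) \<Rightarrow> nat \<Rightarrow> (nat \<Rightarrow> 'l set) \<Rightarrow>
   (nat \<Rightarrow> 'h set) \<Rightarrow> (nat \<Rightarrow> real) \<Rightarrow> (nat \<Rightarrow> 'l \<Rightarrow> 'h) \<Rightarrow> bool" where
  "fusion_frame_system scale m L W w F \<longleftrightarrow>
     fusion_frame scale m W w \<and> (\<forall>i\<in>{1..m}. frame_for scale (W i) (L i) (F i))"

definition frame_synthesis ::
  "('f::conj_normed_field \<Rightarrow> 'h \<Rightarrow> 'h::ab_group_add) \<Rightarrow> nat \<Rightarrow> (nat \<Rightarrow> 'l set) \<Rightarrow>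
   (nat \<Rightarrow> 'l \<Rightarrow> 'h) \<Rightarrow> (nat \<Rightarrow> 'l \<Rightarrow> 'f) \<Rightarrow> (nat \<Rightarrow> 'h)" where
  "frame_synthesis scale m L F x =
     (\<lambda>i. if i \<in> {1..m} then \<Sum>l\<in>L i. scale (x i l) (F i l) else 0)"

definition frame_analysis ::
  "('f::conj_normed_field \<Rightarrow> 'h \<Rightarrow> 'h::ab_group_add) \<Rightarrow> ('h \<Rightarrow> 'h \<Rightarrow> 'f) \<Rightarrow> nat \<Rightarrow>
   (nat \<Rightarrow> 'l set) \<Rightarrow> (nat \<Rightarrow> 'l \<Rightarrow> 'h) \<Rightarrow> (nat \<Rightarrow> 'h) \<Rightarrow> (nat \<Rightarrow> 'l \<Rightarrow> 'f)" where
  "frame_analysis scale ip m L F =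
     adjoint_on (dsum {1..m} (\<lambda>i. coords (L i))) (dsum_ip {1..m} (\<lambda>i. coords_ip (L i)))
       (dsum_ip {1..m} (\<lambda>_. ip)) (frame_synthesis scale m L F)"

definition dual_fusion_frame_system ::
  "('f::conj_normed_field \<Rightarrow> 'h \<Rightarrow> 'h::ab_group_add) \<Rightarrow> ('h \<Rightarrow> 'h \<Rightarrow> 'f) \<Rightarrow> nat \<Rightarrow>
   (nat \<Rightarrow> 'l set) \<Rightarrow>
   (nat \<Rightarrow> 'h set) \<Rightarrow> (nat \<Rightarrow> real) \<Rightarrow> (nat \<Rightarrow> 'l \<Rightarrow> 'h) \<Rightarrow>
   (nat \<Rightarrow> 'h set) \<Rightarrow> (nat \<Rightarrow> real) \<Rightarrow> (nat \<Rightarrow> 'l \<Rightarrow> 'h) \<Rightarrow> bool" where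
  "dual_fusion_frame_system scale ip m L V v G W w F \<longleftrightarrow>
     fusion_frame_system scale m L V v G \<and> fusion_frame_system scale m L W w F \<and>
     Q_dual_fusion_frame scale ip m
       (frame_synthesis scale m L G \<circ> frame_analysis scale ip m L F) V v W w"

end

theory Submission
  imports Defs
begin

text \<open>
  With an orthonormal basis \<open>e\<^sub>l\<close> of the coordinate space, \<open>T\<^sub>i\<^sup>* f = (\<Sum>l. \<langle>f, T\<^sub>i e\<^sub>l\<rangle> e\<^sub>l)\<close>.  Since \<open>T\<^sub>i e\<^sub>l\<close>
  lies in \<open>W\<^sub>i\<close>, projecting \<open>f\<close> to \<open>W\<^sub>i\<close> does not change \<open>\<langle>f, T\<^sub>i e\<^sub>l\<rangle>\<close>, and the weights \<open>w\<^sub>i\<close>, \<open>v\<^sub>i\<close>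
  cancel against the normalisations of \<open>F\<^sub>i\<close>, \<open>G\<^sub>i\<close>.  Hence both composed operators send \<open>f\<close> to
  \<open>\<Sum>i. \<Sum>l. \<langle>f, T\<^sub>i e\<^sub>l\<rangle> T'\<^sub>i e\<^sub>l\<close>.
\<close>

text \<open>All index sets are of the form \<open>{1..n}\<close>; turning \<open>1\<close> into
  \<open>Suc 0\<close> would keep facts about them from matching.\<close>

declare One_nat_def [simp del]

section \<open>Conjugation and pointwise sums\<close>

lemma conjugate_zero [simp]: "conjugate (0 :: 'f::conj_normed_field) = 0"
  using conjugate_add [of 0 "0::'f"] by simp

lemma conjugate_eq_iff: "conjugate x = conjugate y \<longleftrightarrow> x = (y :: 'f::conj_normed_field)"
  by (metis conjugate_conjugate)

lemma conjugate_sum: "conjugate (\<Sum>i\<in>A. f i :: 'f::conj_normed_field) = (\<Sum>i\<in>A. conjugate (f i))"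
  by (induction A rule: infinite_finite_induct) (simp_all add: conjugate_add)

text \<open>The norm axiom gives r * \<open>conjugate\<close> r = r * r for real r, and a nonzero r
  cancels.\<close>

lemma conjugate_of_real [simp]: "conjugate (of_real r :: 'f::conj_normed_field) = of_real r"
proof (cases "r = 0")
  case False
  have "of_real r * conjugate (of_real r :: 'f) = of_real r * of_real r"
    using mult_conjugate [of "of_real r :: 'f"]
    by (simp add: power2_eq_square flip: of_real_def)
  with False show ?thesis by simp
qed simp

lemma sum_fun_apply: "(\<Sum>a\<in>A. f a) i = (\<Sum>a\<in>A. f a i)" for f :: "'a \<Rightarrow> 'i \<Rightarrow> 'x::comm_monoid_add"
  by (induction A rule: infinite_finite_induct) simp_all


subsection \<open>Adjoints via nondegenerate pairings\<close>

text \<open>Exactly the uniqueness needed by the definite description in \<open>adjoint_on\<close>.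
  Asking for no linearity or positivity, it covers scalars, subspaces and direct sums alike.\<close>

definition nondegenerate_on :: "'x set \<Rightarrow> ('x \<Rightarrow> 'x \<Rightarrow> 'f) \<Rightarrow> bool" where
  "nondegenerate_on X ip \<longleftrightarrow> (\<forall>x\<in>X. \<forall>x'\<in>X. (\<forall>z\<in>X. ip z x = ip z x') \<longrightarrow> x = x')"

text \<open>Reduces the computation of an adjoint to exhibiting a representing vector; every adjoint
  below is found this way.\<close>

lemma adjoint_on_eqI:
  assumes "nondegenerate_on X ipX" "x \<in> X" "\<And>z. z \<in> X \<Longrightarrow> ipY (T z) y = ipX z x"
  shows "adjoint_on X ipX ipY T y = x"
  unfolding adjoint_on_def
proof (rule the_equality)
  fix x' assume "x' \<in> X \<and> (\<forall>z\<in>X. ipY (T z) y = ipX z x')"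
  with assms show "x' = x" unfolding nondegenerate_on_def by metis
qed (use assms in blast)

text \<open>Test vectors supported at a single index recover the pairing of that component; outside
  \<open>I\<close> both families vanish by definition of \<open>dsum\<close>.\<close>

lemma nondegenerate_on_dsum:
  fixes ip :: "'i \<Rightarrow> 'x::zero \<Rightarrow> 'x \<Rightarrow> 'f::comm_monoid_add"
  assumes "finite I"
    and "\<And>i. i \<in> I \<Longrightarrow> nondegenerate_on (X i) (ip i)"
    and "\<And>i. i \<in> I \<Longrightarrow> 0 \<in> X i"
    and "\<And>i x. i \<in> I \<Longrightarrow> ip i 0 x = 0"
  shows "nondegenerate_on (dsum I X) (dsum_ip I ip)"
  unfolding nondegenerate_on_def
proof (intro ballI impI)
  fix x x' assume x: "x \<in> dsum I X" "x' \<in> dsum I X"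
    and eq: "\<forall>z\<in>dsum I X. dsum_ip I ip z x = dsum_ip I ip z x'"
  have single: "dsum_ip I ip (\<lambda>j. if j = i then u else 0) y = ip i u (y i)" if "i \<in> I" for i u y
  proof -
    have "dsum_ip I ip (\<lambda>j. if j = i then u else 0) y = (\<Sum>j\<in>I. if j = i then ip i u (y i) else 0)"
      unfolding dsum_ip_def by (rule sum.cong) (simp_all add: assms(4))
    with that assms(1) show ?thesis by simp
  qed
  have "x i = x' i" if "i \<in> I" for i
  proof -
    have "ip i u (x i) = ip i u (x' i)" if "u \<in> X i" for u
    proof -
      have "(\<lambda>j. if j = i then u else 0) \<in> dsum I X"
        using that assms(3) \<open>i \<in> I\<close> by (auto simp: dsum_def)
      with eq have "dsum_ip I ip (\<lambda>j. if j = i then u else 0) x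
          = dsum_ip I ip (\<lambda>j. if j = i then u else 0) x'" by blast
      then show ?thesis by (simp add: single \<open>i \<in> I\<close>)
    qed
    moreover have "x i \<in> X i" "x' i \<in> X i" using x that by (auto simp: dsum_def)
    ultimately show ?thesis
      using assms(2) [OF that] by (simp add: nondegenerate_on_def)
  qed
  then show "x = x'" using x by (force simp: dsum_def)
qed

lemma nondegenerate_on_coords:
  assumes "finite L"
  shows "nondegenerate_on (coords L) (coords_ip L :: _ \<Rightarrow> _ \<Rightarrow> 'f::conj_normed_field)"
  unfolding coords_def coords_ip_def
proof (rule nondegenerate_on_dsum)
  show "nondegenerate_on UNIV (\<lambda>a b::'f. a * conjugate b)"
    unfolding nondegenerate_on_def
  proof (intro ballI impI)
    fix x x' :: 'f assume "\<forall>z\<in>UNIV. z * conjugate x = z * conjugate x'"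
    from bspec [OF this, of 1] show "x = x'" by (simp add: conjugate_eq_iff)
  qed
qed (simp_all add: assms)

text \<open>A direct sum of coordinate spaces is a two-level direct sum, so the componentwise
  criterion applies once more.\<close>

lemma nondegenerate_on_dsum_coords:
  assumes "finite I" "\<And>i. i \<in> I \<Longrightarrow> finite (L i)"
  shows "nondegenerate_on (dsum I (\<lambda>i. coords (L i) :: ('l \<Rightarrow> 'f::conj_normed_field) set))
           (dsum_ip I (\<lambda>i. coords_ip (L i)))"
  by (rule nondegenerate_on_dsum)
     (simp_all add: assms nondegenerate_on_coords, simp_all add: coords_def coords_ip_def dsum_def dsum_ip_def)


subsection \<open>Coordinate spaces\<close>

lemma coords_scale_apply: "coords_scale c x l = c * x l"
  by (simp add: coords_scale_def dsum_scale_def)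

interpretation coords: vector_space "coords_scale :: 'f \<Rightarrow> ('l \<Rightarrow> 'f) \<Rightarrow> ('l \<Rightarrow> 'f::conj_normed_field)"
  by standard (auto simp: coords_scale_apply algebra_simps)

lemma subspace_coords: "coords.subspace (coords L)"
  by (rule coords.subspaceI) (auto simp: coords_def dsum_def coords_scale_apply)

lemma coords_ip_sum_left: "coords_ip L (\<Sum>a\<in>A. x a) y = (\<Sum>a\<in>A. coords_ip L (x a) y)"
  unfolding coords_ip_def dsum_ip_def
  by (subst sum.swap) (simp add: sum_fun_apply sum_distrib_right)

lemma coords_ip_scale_left: "coords_ip L (coords_scale c x) y = c * coords_ip L x y"
  by (simp add: coords_ip_def dsum_ip_def coords_scale_apply sum_distrib_left mult.assoc)

lemma coords_ip_commute: "coords_ip L y x = conjugate (coords_ip L x y)"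
  by (simp add: coords_ip_def dsum_ip_def conjugate_sum conjugate_mult conjugate_conjugate mult.commute)

lemma coords_ip_sum_scale_right:
  "coords_ip L y (\<Sum>a\<in>A. coords_scale (c a) (x a)) = (\<Sum>a\<in>A. conjugate (c a) * coords_ip L y (x a))"
  by (simp add: coords_ip_commute [of L y] coords_ip_sum_left coords_ip_scale_left
      conjugate_sum conjugate_mult)

lemma orthonormal_basis_coords_mem:
  assumes "orthonormal_basis_coords n e" "l \<in> {1..n}"
  shows "e l \<in> coords {1..n}"
  using assms coords.span_base [of "e l" "e ` {1..n}"] by (auto simp: orthonormal_basis_coords_def)

text \<open>Spanning provides some coefficients, and orthonormality identifies them as inner
  products with the basis vectors.\<close>

lemma orthonormal_basis_coords_expansion:
  fixes e :: "nat \<Rightarrow> nat \<Rightarrow> 'f::conj_normed_field"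
  assumes "orthonormal_basis_coords n e" "x \<in> coords {1..n}"
  shows "(\<Sum>l\<in>{1..n}. coords_scale (coords_ip {1..n} x (e l)) (e l)) = x"
proof -
  have on: "coords_ip {1..n} (e k) (e l) = (if k = l then 1 else 0)" if "k \<in> {1..n}" "l \<in> {1..n}" for k l
    using assms(1) that unfolding orthonormal_basis_coords_def by blast
  \<comment> \<open>The span of a finite set yields a sum over the image of \<open>e\<close>;
    injectivity turns it into a sum over indices. A repeated vector would force 1 = 0.\<close>
  have inj: "inj_on e {1..n}"
  proof (rule inj_onI)
    fix k l assume "k \<in> {1..n}" "l \<in> {1..n}" "e k = e l"
    then show "k = l" using on [of k k] on [of k l] by (simp split: if_splits)
  qed
  have "x \<in> coords.span (e ` {1..n})"
    using assms unfolding orthonormal_basis_coords_def by blast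
  then obtain u where "x = (\<Sum>y\<in>e ` {1..n}. coords_scale (u y) y)"
    by (auto simp: coords.span_finite)
  then have x: "x = (\<Sum>k\<in>{1..n}. coords_scale (u (e k)) (e k))"
    by (simp add: sum.reindex [OF inj])
  have "coords_ip {1..n} x (e l) = u (e l)" if "l \<in> {1..n}" for l
  proof -
    have "coords_ip {1..n} x (e l) = (\<Sum>k\<in>{1..n}. if k = l then u (e k) else 0)"
      unfolding x coords_ip_sum_left coords_ip_scale_left
      by (rule sum.cong) (use on that in simp_all)
    with that show ?thesis by simp
  qed
  then show ?thesis
    by (subst (2) x, intro sum.cong) simp_all
qed

text \<open>Since \<open>T\<close> is linear only on its domain, the induction has to keep every
  partial sum inside \<open>coords L\<close>.\<close>

lemma (in fd_hilbert_space) linear_map_on_coords_sum: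
  assumes "linear_map_on coords_scale (coords L) scale UNIV T"
    and "\<And>a. a \<in> A \<Longrightarrow> x a \<in> coords L"
  shows "T (\<Sum>a\<in>A. coords_scale (c a) (x a)) = (\<Sum>a\<in>A. scale (c a) (T (x a)))"
proof -
  have "T (coords_scale 0 0) = scale 0 (T 0)"
    using assms(1) coords.subspace_0 [OF subspace_coords] unfolding linear_map_on_def by blast
  then have T0: "T 0 = 0" by simp
  show ?thesis
    using assms(2)
  proof (induction A rule: infinite_finite_induct)
    case (insert a A)
    have "coords_scale (c a) (x a) \<in> coords L" "(\<Sum>a\<in>A. coords_scale (c a) (x a)) \<in> coords L"
      by (intro coords.subspace_scale coords.subspace_sum subspace_coords insert.prems; simp)+
    then show ?case
      using insert assms(1) unfolding linear_map_on_def by (simp del: plus_fun_apply)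
  qed (simp_all add: T0)
qed


lemma (in fd_hilbert_space) linear_map_on_coords_expansion:
  assumes "linear_map_on coords_scale (coords {1..n}) scale UNIV T"
    and e: "orthonormal_basis_coords n e" and "x \<in> coords {1..n}"
  shows "T x = (\<Sum>l\<in>{1..n}. scale (coords_ip {1..n} x (e l)) (T (e l)))"
  using linear_map_on_coords_sum [OF assms(1) orthonormal_basis_coords_mem [OF e],
      of "{1..n}" "\<lambda>l. l" "\<lambda>l. coords_ip {1..n} x (e l)"]
  by (simp add: orthonormal_basis_coords_expansion [OF e assms(3)])


subsection \<open>Analysis operators\<close>

context fd_hilbert_space
begin

lemma ip_zero_left [simp]: "ip 0 x = 0"
  using ip_scale_left [of 0 0 x] by simp

lemma ip_sum_left: "ip (\<Sum>a\<in>A. x a) y = (\<Sum>a\<in>A. ip (x a) y)"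
  by (induction A rule: infinite_finite_induct) (simp_all add: ip_add_left)

lemma ip_add_right: "ip x (y + z) = ip x y + ip x z"
  by (simp add: ip_commute [of x] ip_add_left conjugate_add)

lemma ip_scale_right: "ip x (scale c y) = conjugate c * ip x y"
  by (simp add: ip_commute [of x] ip_scale_left conjugate_mult)

text \<open>The difference \<open>x - x'\<close> lies in \<open>U\<close>, hence is an admissible
  test vector, and it turns out orthogonal to itself.\<close>

lemma nondegenerate_on_subspace:
  assumes "subspace U"
  shows "nondegenerate_on U ip"
  unfolding nondegenerate_on_def
proof (intro ballI impI)
  fix x x' assume "x \<in> U" "x' \<in> U" "\<forall>z\<in>U. ip z x = ip z x'"
  moreover have "x - x' \<in> U" using assms calculation by (blast intro: subspace_diff)
  ultimately have "ip (x - x') x = ip (x - x') x'" by blast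
  then have "ip (x - x') ((x - x') + x') = ip (x - x') x'" by simp
  then have "ip (x - x') (x - x') = 0" unfolding ip_add_right by simp
  then show "x = x'" using ip_self_eq_zero by force
qed

text \<open>Expanding \<open>z\<close> in the basis verifies the adjoint identity term by term,
  conjugate symmetry absorbing the conjugated coefficients. Membership and identity are kept as
  separate facts for reuse on direct sums.\<close>

lemma adjoint_on_coords_adjoint:
  assumes lin: "linear_map_on coords_scale (coords {1..n}) scale UNIV T"
    and e: "orthonormal_basis_coords n e"
  defines "a \<equiv> \<lambda>f. \<Sum>l\<in>{1..n}. coords_scale (ip f (T (e l))) (e l)"
  shows "a f \<in> coords {1..n}"
    and "z \<in> coords {1..n} \<Longrightarrow> ip (T z) f = coords_ip {1..n} z (a f)"
    and "adjoint_on (coords {1..n}) (coords_ip {1..n}) ip T f = a f"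
proof -
  show mem: "a f \<in> coords {1..n}"
    unfolding a_def
    by (intro coords.subspace_sum coords.subspace_scale subspace_coords orthonormal_basis_coords_mem [OF e])
  show eq: "ip (T z) f = coords_ip {1..n} z (a f)" if z: "z \<in> coords {1..n}" for z
    by (simp add: linear_map_on_coords_expansion [OF lin e z] a_def coords_ip_sum_scale_right
        ip_sum_left ip_scale_left mult.commute flip: ip_commute)
  show "adjoint_on (coords {1..n}) (coords_ip {1..n}) ip T f = a f"
    by (rule adjoint_on_eqI) (simp_all only: nondegenerate_on_coords finite_atLeastAtMost mem eq)
qed

text \<open>The orthogonal projection of \<open>f\<close> to the range is \<open>c\<^sup>-\<^sup>2 T T\<^sup>* f\<close>.\<close>

lemma projection_onto_range:
  fixes T :: "(nat \<Rightarrow> 'f) \<Rightarrow> 'h" and e :: "nat \<Rightarrow> nat \<Rightarrow> 'f"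
  assumes lin: "linear_map_on coords_scale (coords {1..n}) scale UNIV T"
    and e: "orthonormal_basis_coords n e"
    and c: "c > 0" and cc: "\<And>x. x \<in> coords {1..n} \<Longrightarrow>
      adjoint_on (coords {1..n}) (coords_ip {1..n}) ip T (T x) = coords_scale (of_real (c\<^sup>2)) x"
  shows "\<exists>p\<in>T ` coords {1..n}. \<forall>z\<in>T ` coords {1..n}. ip z p = ip z f"
proof -
  define a where "a f = (\<Sum>l\<in>{1..n}. coords_scale (ip f (T (e l))) (e l))" for f
  note adj = adjoint_on_coords_adjoint [OF lin e, folded a_def]
  let ?x = "coords_scale (of_real (inverse (c\<^sup>2))) (a f)"
  have x: "?x \<in> coords {1..n}"
    by (intro coords.subspace_scale subspace_coords adj(1))
  \<comment> \<open>As T*T is c^2 times the identity, \<open>T ?x\<close> and \<open>f\<close> have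
    the same image under T*, hence the same inner products with the range of
    \<open>T\<close>.\<close>
  have "a (T ?x) = a f"
    using cc [OF x] \<open>c > 0\<close> by (simp add: adj(3) flip: of_real_mult)
  then have "ip (T z) (T ?x) = ip (T z) f" if "z \<in> coords {1..n}" for z
    using adj(2) [OF that] by simp
  with x show ?thesis by blast
qed

text \<open>The adjoint of a sum of maps on a direct sum acts componentwise; the value 0 outside
  \<open>{1..m}\<close> puts it into \<open>dsum\<close>.\<close>

lemma analysis_eq:
  assumes "\<And>i. i \<in> {1..m} \<Longrightarrow> linear_map_on coords_scale (coords {1..n i}) scale UNIV (T i)"
    and "\<And>i. i \<in> {1..m} \<Longrightarrow> orthonormal_basis_coords (n i) (e i)"
  shows "analysis ip m n T f =
    (\<lambda>i. if i \<in> {1..m} then \<Sum>l\<in>{1..n i}. coords_scale (ip f (T i (e i l))) (e i l) else 0)"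
    (is "_ = ?a")
  unfolding analysis_def
proof (rule adjoint_on_eqI)
  note adj = adjoint_on_coords_adjoint [OF assms]
  show "?a \<in> dsum {1..m} (\<lambda>i. coords {1..n i})"
    by (simp add: dsum_def adj(1))
  show "ip (synthesis m T z) f = dsum_ip {1..m} (\<lambda>i. coords_ip {1..n i}) z ?a"
    if "z \<in> dsum {1..m} (\<lambda>i. coords {1..n i})" for z
    unfolding synthesis_def dsum_ip_def ip_sum_left
  proof (rule sum.cong)
    fix i assume "i \<in> {1..m}"
    with that show "ip (T i (z i)) f = coords_ip {1..n i} (z i) (?a i)"
      by (subst adj(2)) (auto simp: dsum_def)
  qed simp
qed (simp add: nondegenerate_on_dsum_coords)

text \<open>Here \<open>p i\<close> is the orthogonal projection of \<open>f\<close> onto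
  \<open>W i\<close>, given only through its inner products with \<open>W i\<close>. The weights are
  real, so conjugation leaves them unchanged.\<close>

lemma fusion_analysis_eq:
  assumes "\<And>i. i \<in> {1..m} \<Longrightarrow> subspace (W i)"
    and "\<And>i. i \<in> {1..m} \<Longrightarrow> p i \<in> W i"
    and "\<And>i z. i \<in> {1..m} \<Longrightarrow> z \<in> W i \<Longrightarrow> ip z (p i) = ip z f"
  shows "fusion_analysis scale ip m W w f = (\<lambda>i. if i \<in> {1..m} then scale (of_real (w i)) (p i) else 0)"
    (is "_ = ?a")
  unfolding fusion_analysis_def
proof (rule adjoint_on_eqI)
  show "nondegenerate_on (dsum {1..m} W) (dsum_ip {1..m} (\<lambda>_. ip))"
    by (rule nondegenerate_on_dsum) (simp_all add: assms nondegenerate_on_subspace subspace_0)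
  show "?a \<in> dsum {1..m} W"
    by (simp add: dsum_def assms subspace_scale)
  show "ip (fusion_synthesis scale m w z) f = dsum_ip {1..m} (\<lambda>_. ip) z ?a"
    if "z \<in> dsum {1..m} W" for z
    unfolding fusion_synthesis_def dsum_ip_def ip_sum_left
    by (rule sum.cong) (use that in \<open>simp_all add: dsum_def assms ip_scale_left ip_scale_right\<close>)
qed

lemma frame_analysis_eq:
  assumes "\<And>i. i \<in> {1..m} \<Longrightarrow> finite (L i)"
  shows "frame_analysis scale ip m L F g =
    (\<lambda>i l. if i \<in> {1..m} \<and> l \<in> L i then ip (g i) (F i l) else 0)"
    (is "_ = ?a")
  unfolding frame_analysis_def
proof (rule adjoint_on_eqI)
  show "?a \<in> dsum {1..m} (\<lambda>i. coords (L i))"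
    by (auto simp: dsum_def coords_def)
  show "dsum_ip {1..m} (\<lambda>_. ip) (frame_synthesis scale m L F z) g =
      dsum_ip {1..m} (\<lambda>i. coords_ip (L i)) z ?a" for z
    unfolding dsum_ip_def
    by (rule sum.cong)
       (simp_all add: frame_synthesis_def coords_ip_def dsum_ip_def ip_sum_left ip_scale_left
         flip: ip_commute)
qed (rule nondegenerate_on_dsum_coords [OF finite_atLeastAtMost assms])

lemma frame_synthesis_frame_analysis:
  assumes "\<And>i. i \<in> {1..m} \<Longrightarrow> finite (L i)"
  shows "frame_synthesis scale m L G (frame_analysis scale ip m L F g) =
    (\<lambda>i. if i \<in> {1..m} then \<Sum>l\<in>L i. scale (ip (g i) (F i l)) (G i l) else 0)"
proof -
  have "frame_analysis scale ip m L F g =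
      (\<lambda>i l. if i \<in> {1..m} \<and> l \<in> L i then ip (g i) (F i l) else 0)"
    by (rule frame_analysis_eq) (rule assms)
  then show ?thesis by (auto simp: frame_synthesis_def)
qed

text \<open>Supplies the linearity of \<open>Q\<close> required of a \<open>Q\<close>-dual. It is
  inherited from \<open>ip\<close> in its first argument and holds for all families, so the domain
  \<open>X\<close> can be any set.\<close>

lemma linear_map_on_frame_synthesis_frame_analysis:
  assumes "\<And>i. i \<in> {1..m} \<Longrightarrow> finite (L i)"
    and "\<And>i. i \<in> {1..m} \<Longrightarrow> subspace (V i)"
    and "\<And>i l. i \<in> {1..m} \<Longrightarrow> l \<in> L i \<Longrightarrow> G i l \<in> V i"
  shows "linear_map_on (dsum_scale scale) X (dsum_scale scale) (dsum {1..m} V)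
    (frame_synthesis scale m L G \<circ> frame_analysis scale ip m L F)"
proof -
  have Q: "frame_synthesis scale m L G (frame_analysis scale ip m L F g) =
      (\<lambda>i. if i \<in> {1..m} then \<Sum>l\<in>L i. scale (ip (g i) (F i l)) (G i l) else 0)" for g
    by (rule frame_synthesis_frame_analysis) (rule assms)
  show ?thesis
    unfolding linear_map_on_def o_apply Q
    by (auto simp: dsum_def dsum_scale_def fun_eq_iff assms ip_add_left ip_scale_left scale_left_distrib
        sum.distrib scale_sum_right intro!: subspace_sum subspace_scale)
qed

text \<open>The images of a basis span the range, and a common nonzero factor does not change the
  span. The factors used later are the inverse weights.\<close>

lemma frame_for_range:
  assumes lin: "linear_map_on coords_scale (coords {1..n}) scale UNIV T"
    and e: "orthonormal_basis_coords n e"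
    and W: "T ` coords {1..n} = W" "subspace W"
    and F: "\<And>l. l \<in> {1..n} \<Longrightarrow> F l = scale c (T (e l))" and "c \<noteq> 0"
  shows "frame_for scale W {1..n} F"
  unfolding frame_for_def
proof (intro conjI subset_antisym)
  have Te: "T (e l) \<in> W" if "l \<in> {1..n}" for l
    using W(1) orthonormal_basis_coords_mem [OF e that] by blast
  then have "F ` {1..n} \<subseteq> W"
    using subspace_scale [OF W(2)] by (auto simp: F)
  then show "span (F ` {1..n}) \<subseteq> W"
    using W(2) by (rule span_minimal)
  have TF: "T (e l) \<in> span (F ` {1..n})" if "l \<in> {1..n}" for l
  proof -
    have "T (e l) = scale (inverse c) (F l)" by (simp only: F [OF that]) (simp add: \<open>c \<noteq> 0\<close>)
    then show ?thesis using that by (simp add: span_base span_scale)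
  qed
  show "W \<subseteq> span (F ` {1..n})"
  proof
    fix y assume "y \<in> W"
    then obtain z where z: "z \<in> coords {1..n}" "y = T z" using W(1) by blast
    show "y \<in> span (F ` {1..n})"
      unfolding z(2) linear_map_on_coords_expansion [OF lin e z(1)]
      by (intro span_sum span_scale TF)
  qed
qed simp

end

section \<open>Equivalence of the two duality conditions\<close>

theorem corollary4p9:
  fixes scale :: "'f::conj_normed_field \<Rightarrow> 'h::ab_group_add \<Rightarrow> 'h"
    and ip :: "'h \<Rightarrow> 'h \<Rightarrow> 'f"
    and m :: nat and n :: "nat \<Rightarrow> nat"
    and W V :: "nat \<Rightarrow> 'h set" and w v :: "nat \<Rightarrow> real"
    and T T' :: "nat \<Rightarrow> (nat \<Rightarrow> 'f) \<Rightarrow> 'h"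
    and e :: "nat \<Rightarrow> nat \<Rightarrow> (nat \<Rightarrow> 'f)"
    and F G :: "nat \<Rightarrow> nat \<Rightarrow> 'h"
  assumes "fd_hilbert_space scale ip"
    and "fusion_frame scale m W w"
    and "fusion_frame scale m V v"
    and "projective_reconstruction_system scale ip m n T"
    and "projective_reconstruction_system scale ip m n T'"
    and "\<And>i. i \<in> {1..m} \<Longrightarrow> T i ` coords {1..n i} = W i"
    and "\<And>i. i \<in> {1..m} \<Longrightarrow> spectral_norm (coords {1..n i}) (coords_ip {1..n i}) ip (T i) = w i"
    and "\<And>i. i \<in> {1..m} \<Longrightarrow> T' i ` coords {1..n i} = V i"
    and "\<And>i. i \<in> {1..m} \<Longrightarrow> spectral_norm (coords {1..n i}) (coords_ip {1..n i}) ip (T' i) = v i"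
    and "\<And>i. i \<in> {1..m} \<Longrightarrow> orthonormal_basis_coords (n i) (e i)"
    and "\<And>i l. i \<in> {1..m} \<Longrightarrow> l \<in> {1..n i} \<Longrightarrow> F i l = scale (of_real (1 / w i)) (T i (e i l))"
    and "\<And>i l. i \<in> {1..m} \<Longrightarrow> l \<in> {1..n i} \<Longrightarrow> G i l = scale (of_real (1 / v i)) (T' i (e i l))"
  shows "dual_fusion_frame_system scale ip m (\<lambda>i. {1..n i}) V v G W w F \<longleftrightarrow>
         dual_reconstruction_system scale ip m n T' T"
proof -
  interpret fd_hilbert_space scale ip by fact
  let ?L = "\<lambda>i. {1..n i}"
  have rs: "reconstruction_system scale m n T" "reconstruction_system scale m n T'"
    using assms(4,5) by (simp_all add: projective_reconstruction_system_def)
  have lin: "linear_map_on coords_scale (coords {1..n i}) scale UNIV (T i)"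
    and lin': "linear_map_on coords_scale (coords {1..n i}) scale UNIV (T' i)" if "i \<in> {1..m}" for i
    using rs that by (simp_all add: reconstruction_system_def)
  have sub: "subspace (W i)" "subspace (V i)" and pos: "w i > 0" "v i > 0" if "i \<in> {1..m}" for i
    using assms(2,3) that by (simp_all add: fusion_frame_def)
  have e: "e i l \<in> coords {1..n i}" if "i \<in> {1..m}" "l \<in> {1..n i}" for i l
    using orthonormal_basis_coords_mem assms(10) that by blast
  have ffs: "fusion_frame_system scale m ?L W w F" "fusion_frame_system scale m ?L V v G"
  proof -
    have "frame_for scale (W i) {1..n i} (F i)" "frame_for scale (V i) {1..n i} (G i)"
      if i: "i \<in> {1..m}" for i
      using frame_for_range [OF lin [OF i] assms(10,6) [OF i] sub(1) [OF i] assms(11) [OF i]]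
        frame_for_range [OF lin' [OF i] assms(10,8) [OF i] sub(2) [OF i] assms(12) [OF i]]
        pos [OF i] by simp_all
    with assms(2,3) show "fusion_frame_system scale m ?L W w F" "fusion_frame_system scale m ?L V v G"
      unfolding fusion_frame_system_def by blast+
  qed
  have G: "G i l \<in> V i" if "i \<in> {1..m}" "l \<in> {1..n i}" for i l
    using ffs(2) that span_base [of "G i l" "G i ` {1..n i}"]
    by (auto simp: fusion_frame_system_def frame_for_def)
  have linQ: "linear_map_on (dsum_scale scale) (dsum {1..m} W) (dsum_scale scale) (dsum {1..m} V)
      (frame_synthesis scale m ?L G \<circ> frame_analysis scale ip m ?L F)"
    by (rule linear_map_on_frame_synthesis_frame_analysis) (simp_all add: sub G)
  \<comment> \<open>The heart of the matter: the two composed operators agree at every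
    \<open>f\<close>, so one is the identity exactly when the other is.\<close>
  have "fusion_synthesis scale m v ((frame_synthesis scale m ?L G \<circ> frame_analysis scale ip m ?L F)
      (fusion_analysis scale ip m W w f)) = synthesis m T' (analysis ip m n T f)" for f
  proof -
    have "\<exists>p\<in>W i. \<forall>z\<in>W i. ip z p = ip z f" if i: "i \<in> {1..m}" for i
    proof -
      obtain c where "c > 0" "\<And>x. x \<in> coords {1..n i} \<Longrightarrow>
          adjoint_on (coords {1..n i}) (coords_ip {1..n i}) ip (T i) (T i x) =
            coords_scale (of_real (c\<^sup>2)) x"
        using assms(4) i unfolding projective_reconstruction_system_def by blast
      from projection_onto_range [OF lin [OF i] assms(10) [OF i] this] show ?thesis
        by (simp add: assms(6) [OF i])
    qed
    then obtain p where p: "\<And>i. i \<in> {1..m} \<Longrightarrow> p i \<in> W i"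
      "\<And>i z. i \<in> {1..m} \<Longrightarrow> z \<in> W i \<Longrightarrow> ip z (p i) = ip z f"
      by metis
    have fa: "fusion_analysis scale ip m W w f =
        (\<lambda>i. if i \<in> {1..m} then scale (of_real (w i)) (p i) else 0)"
      by (rule fusion_analysis_eq [OF sub(1) p])
    have coeff: "ip (scale (of_real (w i)) (p i)) (F i l) = ip f (T i (e i l))"
      if "i \<in> {1..m}" "l \<in> {1..n i}" for i l
    proof -
      have "T i (e i l) \<in> W i" using assms(6) e that by blast
      then have "ip (p i) (T i (e i l)) = ip f (T i (e i l))"
        \<comment> \<open>The projection is characterised in the second slot; conjugate symmetry
          moves it to the first.\<close>
        using p(2) that(1) ip_commute by metis
      moreover have "conjugate (of_real (1 / w i)) * of_real (w i) = (1 :: 'f)"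
        unfolding conjugate_of_real using pos(1) [OF that(1)] by simp
      ultimately show ?thesis
        unfolding assms(11) [OF that] ip_scale_left ip_scale_right
        by (simp only: mult_1_left flip: mult.assoc)
    qed
    have "scale (of_real (v i)) (\<Sum>l\<in>{1..n i}. scale (ip (scale (of_real (w i)) (p i)) (F i l)) (G i l)) =
        T' i (\<Sum>l\<in>{1..n i}. coords_scale (ip f (T i (e i l))) (e i l))" if i: "i \<in> {1..m}" for i
    proof -
      \<comment> \<open>The outer weight cancels the normalisation of \<open>G i l\<close> around an
        arbitrary scalar, here the coefficient from \<open>coeff\<close>.\<close>
      have "of_real (v i) * (c * of_real (1 / v i)) = c" for c :: 'f
        using pos(2) [OF i] by simp
      then have "scale (of_real (v i)) (scale (ip (scale (of_real (w i)) (p i)) (F i l)) (G i l)) =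
          scale (ip f (T i (e i l))) (T' i (e i l))" if "l \<in> {1..n i}" for l
        unfolding coeff [OF i that] assms(12) [OF i that] scale_scale by (rule arg_cong)
      moreover have "T' i (\<Sum>l\<in>{1..n i}. coords_scale (ip f (T i (e i l))) (e i l)) =
          (\<Sum>l\<in>{1..n i}. scale (ip f (T i (e i l))) (T' i (e i l)))"
        by (rule linear_map_on_coords_sum [OF lin' [OF i]], rule e [OF i])
      ultimately show ?thesis
        unfolding scale_sum_right by simp
    qed
    moreover have "analysis ip m n T f =
        (\<lambda>i. if i \<in> {1..m} then \<Sum>l\<in>{1..n i}. coords_scale (ip f (T i (e i l))) (e i l) else 0)"
      by (rule analysis_eq, rule lin, assumption, rule assms(10))
    ultimately show ?thesis
      unfolding o_apply frame_synthesis_frame_analysis [OF finite_atLeastAtMost] fa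
      by (simp add: fusion_synthesis_def synthesis_def)
  qed
  \<comment> \<open>All side conditions of both notions are already established, so only the two
    operator identities remain to be compared.\<close>
  then show ?thesis
    unfolding dual_fusion_frame_system_def dual_reconstruction_system_def Q_dual_fusion_frame_def
    using ffs linQ assms(2,3) rs by simp
qed

end
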